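(* Let $\mathfrak k$ be a Lie subalgebra of $W$ of finite codimension. (a) If $\mathrm{codim}_W\mathfrak k=2$ then $|\mathrm{supp}(\mathfrak k)|\in\{1,2\}$. (b) If $\mathrm{codim}_W\mathfrak k=2$ and $|\mathrm{supp}(\mathfrak k)|=2$ then $\mathfrak k=W((t-x)(t-y))$ and $\mathrm{supp}(\mathfrak k)=\{x,y\}$ for some $x\neq y\in\Bbbk^\times$.
   Context: $\Bbbk$ is an uncountable algebraically closed field of characteristic $0$; $\partial=d/dt$. $W=\Bbbk[t,t^{-1}]\partial$ is the Witt algebra, with $[f\partial,g\partial]=(fg'-f'g)\partial$. For $f\in\Bbbk[t,t^{-1}]$, $W(f)=f\,\Bbbk[t,t^{-1}]\partial$. For a subalgebra $\mathfrak k\subseteq W$ of finite codimension, $\mathrm{supp}(\mathfrak k)=\{x\in\Bbbk^\times:\mathfrak k\subseteq W(t-x)\}$. *)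

theory Defs
  imports
    Complex_Main
    "HOL-Library.Poly_Mapping"
    "HOL-Library.Countable_Set"
    "HOL-Computational_Algebra.Polynomial"
begin

text \<open>A Laurent polynomial is a finitely supported function from exponents to coefficients;
  the convolution product of \<^theory>\<open>HOL-Library.Poly_Mapping\<close> is its multiplication.\<close>

type_synonym 'a laurent = "int \<Rightarrow>\<^sub>0 'a"

abbreviation laurent_const :: "'a::zero \<Rightarrow> 'a laurent" where
  "laurent_const c \<equiv> Poly_Mapping.single 0 c"

abbreviation laurent_t :: "'a::zero_neq_one laurent" where
  "laurent_t \<equiv> Poly_Mapping.single 1 1"

definition laurent_scale :: "'a::comm_ring_1 \<Rightarrow> 'a laurent \<Rightarrow> 'a laurent" where
  "laurent_scale c f = laurent_const c * f"

definition laurent_deriv :: "'a::comm_ring_1 laurent \<Rightarrow> 'a laurent" where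
  "laurent_deriv f =
     (\<Sum>n\<in>Poly_Mapping.keys f. Poly_Mapping.single (n - 1) (of_int n * Poly_Mapping.lookup f n))"

text \<open>\<open>B\<close> is a finite set of vectors whose classes form a basis of the quotient of the whole space
  by the subspace \<open>U\<close>, with distinct elements of \<open>B\<close> having distinct classes. As with
  \<open>dim\<close>, the value of \<open>codim\<close> is only meaningful in the finite case.\<close>

definition quotient_basis ::
    "('a::field \<Rightarrow> 'b::ab_group_add \<Rightarrow> 'b) \<Rightarrow> 'b set \<Rightarrow> 'b set \<Rightarrow> bool" where
  "quotient_basis scale U B \<longleftrightarrow> finite B \<and>
     (\<forall>c. (\<Sum>b\<in>B. scale (c b) b) \<in> U \<longrightarrow> (\<forall>b\<in>B. c b = 0)) \<and>
     (\<forall>v. \<exists>c. v - (\<Sum>b\<in>B. scale (c b) b) \<in> U)"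

definition finite_codim ::
    "('a::field \<Rightarrow> 'b::ab_group_add \<Rightarrow> 'b) \<Rightarrow> 'b set \<Rightarrow> bool" where
  "finite_codim scale U \<longleftrightarrow> (\<exists>B. quotient_basis scale U B)"

definition codim ::
    "('a::field \<Rightarrow> 'b::ab_group_add \<Rightarrow> 'b) \<Rightarrow> 'b set \<Rightarrow> nat" where
  "codim scale U = card (SOME B. quotient_basis scale U B)"

global_interpretation laurent: vector_space "laurent_scale :: 'a::field \<Rightarrow> 'a laurent \<Rightarrow> 'a laurent"
proof
  fix a b :: 'a and f g :: "'a laurent"
  show "laurent_scale a (f + g) = laurent_scale a f + laurent_scale a g"
    by (simp add: laurent_scale_def distrib_left)
  show "laurent_scale (a + b) f = laurent_scale a f + laurent_scale b f"
    by (simp add: laurent_scale_def single_add distrib_right)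
  show "laurent_scale a (laurent_scale b f) = laurent_scale (a * b) f"
    by (simp add: laurent_scale_def mult_single mult.assoc[symmetric])
  show "laurent_scale 1 f = f"
    by (simp add: laurent_scale_def)
qed

text \<open>The element \<open>f \<partial>\<close> of the Witt algebra is represented by its coefficient \<open>f\<close>, so the Witt
  algebra is the whole type of Laurent polynomials.\<close>

definition witt_bracket :: "'a::comm_ring_1 laurent \<Rightarrow> 'a laurent \<Rightarrow> 'a laurent" where
  "witt_bracket f g = f * laurent_deriv g - laurent_deriv f * g"

definition witt_subalgebra :: "'a::field laurent set \<Rightarrow> bool" where
  "witt_subalgebra L \<longleftrightarrow> laurent.subspace L \<and> (\<forall>f\<in>L. \<forall>g\<in>L. witt_bracket f g \<in> L)"

definition witt_multiples :: "'a::comm_ring_1 laurent \<Rightarrow> 'a laurent set" where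
  "witt_multiples f = {f * g | g. True}"

definition witt_supp :: "'a::field laurent set \<Rightarrow> 'a set" where
  "witt_supp L = {x. x \<noteq> 0 \<and> L \<subseteq> witt_multiples (laurent_t - laurent_const x)}"

end

theory Submission imports Defs begin

text \<open>
  Everything rests on the fact that a proper subalgebra \<open>L\<close> of finite codimension has nonempty
  support (\<open>witt_supp_nonempty\<close>).

  Such an \<open>L\<close> contains a nonzero ideal of \<open>R = k[t, t\<inverse>]\<close>. Indeed, if \<open>f\<close>, \<open>tf\<close>, \<open>g\<close> and \<open>tg\<close>
  lie in \<open>L\<close>, then so does \<open>[f, tg] - [tf, g] = 2fg\<close>. Hence the product of any two elements of
  \<open>V = {f. f \<in> L \<and> tf \<in> L}\<close> lies in \<open>L\<close>. Since \<open>V\<close> has finite codimension, \<open>R = V + span B\<close> with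
  \<open>B\<close> finite, and the finitely many linear conditions \<open>q \<in> V\<close>, \<open>qb \<in> L\<close> (\<open>b \<in> B\<close>) have a common
  nonzero solution \<open>q\<close> in the infinite-dimensional space \<open>R\<close>. Then \<open>qR = qV + q span B \<subseteq> L\<close>.

  Now let \<open>p\<close> be a nonzero polynomial of least degree with \<open>pR \<subseteq> L\<close>; it divides every polynomial
  \<open>s\<close> with \<open>sR \<subseteq> L\<close>. If \<open>L\<close> is proper, \<open>p\<close> is not constant and has a root \<open>x\<close>, and \<open>x \<noteq> 0\<close>
  because \<open>t\<close> is a unit. For \<open>g \<in> L\<close> the bracket \<open>[g, ph]\<close> differs from \<open>p'gh\<close> by an element
  of \<open>pR\<close>; so \<open>p'gR \<subseteq> L\<close>, whence \<open>p\<close> divides \<open>p'g\<close> in \<open>R\<close>.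
  In characteristic 0 the order of \<open>p'\<close> at \<open>x\<close> is one less than that of \<open>p\<close>, so \<open>g(x) = 0\<close>.
  Thus \<open>x\<close> belongs to the support.

  In the other direction, evaluations at distinct points are linearly independent functionals on
  \<open>R\<close>, and those at points of the support vanish on \<open>L\<close>. So the support has at most \<open>codim L\<close>
  points, and if it has exactly that many, \<open>L\<close> is the common kernel of these evaluations
  (\<open>witt_supp_bounded_by_codim\<close>), which for two points \<open>x\<close> and \<open>y\<close> is the ideal generated by
  \<open>(t - x)(t - y)\<close>.
\<close>

section \<open>Derivation on Laurent polynomials\<close>

text \<open>Reduces additive statements to monomials, and statements about products to products of
  monomials.\<close>

lemma laurent_induct [case_names single add]:
  fixes f :: "'a::comm_monoid_add laurent"
  assumes "\<And>n c. P (Poly_Mapping.single n c)" and "\<And>f g. P f \<Longrightarrow> P g \<Longrightarrow> P (f + g)"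
  shows "P f"
proof -
  have "P (\<Sum>n\<in>K. Poly_Mapping.single n (Poly_Mapping.lookup f n))" if "finite K" for K
    using that by (induction K) (auto intro: assms simp: assms(1)[of 0 0, simplified])
  moreover have "(\<Sum>n\<in>Poly_Mapping.keys f. Poly_Mapping.single n (Poly_Mapping.lookup f n)) = f"
    by (rule poly_mapping_eqI) (simp add: lookup_sum lookup_single when_def in_keys_iff)
  ultimately show ?thesis
    using finite_keys[of f] by metis
qed

lemma laurent_deriv_add: "laurent_deriv (f + g) = laurent_deriv f + laurent_deriv g"
  unfolding laurent_deriv_def
  by (rule setsum_keys_plus_distrib) (simp_all add: single_add[symmetric] distrib_left)

lemma laurent_deriv_single:
  "laurent_deriv (Poly_Mapping.single n c) = Poly_Mapping.single (n - 1) (of_int n * c)"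
  by (cases "c = 0") (simp_all add: laurent_deriv_def)

lemma laurent_deriv_mult: "laurent_deriv (f * g) = laurent_deriv f * g + f * laurent_deriv g"
proof (induction f rule: laurent_induct)
  case (single m a)
  show ?case
  proof (induction g rule: laurent_induct)
    case (single n b)
    show ?case
      by (simp add: mult_single laurent_deriv_single single_add[symmetric] algebra_simps)
  qed (simp add: laurent_deriv_add algebra_simps)
qed (simp add: laurent_deriv_add algebra_simps)

lemma laurent_deriv_const: "laurent_deriv (laurent_const c) = 0"
  and laurent_deriv_t: "laurent_deriv laurent_t = 1"
  by (simp_all add: laurent_deriv_single)

section \<open>Polynomials inside Laurent polynomials\<close>

text \<open>The embedding of polynomials is written as a value at \<open>t\<close>, so that recursion on
  \<^const>\<open>pCons\<close> is immediate.\<close>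

definition laurent_of_poly :: "'a::comm_ring_1 poly \<Rightarrow> 'a laurent" where
  "laurent_of_poly p = poly (map_poly laurent_const p) laurent_t"

lemma laurent_of_poly_0 [simp]: "laurent_of_poly 0 = 0"
  by (simp add: laurent_of_poly_def)

lemma laurent_of_poly_pCons [simp]:
  "laurent_of_poly (pCons a p) = laurent_const a + laurent_t * laurent_of_poly p"
  by (simp add: laurent_of_poly_def map_poly_pCons)

lemma laurent_of_poly_add: "laurent_of_poly (p + q) = laurent_of_poly p + laurent_of_poly q"
  by (induction p q rule: poly_induct2) (simp_all add: single_add algebra_simps)

lemma laurent_of_poly_smult: "laurent_of_poly (smult c p) = laurent_const c * laurent_of_poly p"
  by (induction p) (simp_all add: mult_single algebra_simps)

lemma laurent_of_poly_mult: "laurent_of_poly (p * q) = laurent_of_poly p * laurent_of_poly q"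
  by (induction p) (simp_all add: laurent_of_poly_add laurent_of_poly_smult algebra_simps)

lemma laurent_of_poly_monom:
  "laurent_of_poly (monom c n) = Poly_Mapping.single (int n) c"
  by (induction n) (simp_all add: monom_0 monom_Suc mult_single)

lemma laurent_of_poly_pderiv:
  "laurent_of_poly (pderiv p) = laurent_deriv (laurent_of_poly p)"
  by (induction p)
     (simp_all add: pderiv_pCons laurent_of_poly_add laurent_deriv_add laurent_deriv_mult
       laurent_deriv_const laurent_deriv_t algebra_simps laurent_deriv_const[of 0, simplified])

lemma laurent_cofactor_poly:
  fixes f :: "'a::comm_ring_1 laurent"
  obtains m :: nat and p where "Poly_Mapping.single (int m) 1 * f = laurent_of_poly p"
proof -
  have "\<exists>(m :: nat) p. Poly_Mapping.single (int m) 1 * f = laurent_of_poly p"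
  proof (induction f rule: laurent_induct)
    case (single n c)
    have "Poly_Mapping.single (int (nat (-n))) 1 * Poly_Mapping.single n c
        = laurent_of_poly (monom c (nat (int (nat (-n)) + n)))"
      by (simp add: mult_single laurent_of_poly_monom)
    then show ?case by blast
  next
    case (add f g)
    then obtain m n :: nat and p q where
      mp: "Poly_Mapping.single (int m) 1 * f = laurent_of_poly p" and
      nq: "Poly_Mapping.single (int n) 1 * g = laurent_of_poly q" by blast
    have "laurent_of_poly (monom 1 n * p + monom 1 m * q)
        = (Poly_Mapping.single (int m) 1 * Poly_Mapping.single (int n) 1) * (f + g)"
      unfolding laurent_of_poly_add laurent_of_poly_mult laurent_of_poly_monom mp[symmetric] nq[symmetric]
      by (simp only: distrib_left distrib_right ac_simps)
    also have "Poly_Mapping.single (int m) (1::'a) * Poly_Mapping.single (int n) 1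
        = Poly_Mapping.single (int (m + n)) 1"
      by (simp add: mult_single)
    finally have "Poly_Mapping.single (int (m + n)) 1 * (f + g)
        = laurent_of_poly (monom 1 n * p + monom 1 m * q)" by (rule sym)
    then show ?case by blast
  qed
  with that show thesis by blast
qed

text \<open>Since \<open>t\<close> is a unit, questions about ideals and nonzero roots of Laurent polynomials become
  questions about ordinary polynomials.\<close>

lemma laurent_eq_shift_poly:
  fixes f :: "'a::comm_ring_1 laurent"
  obtains m :: int and p where "f = Poly_Mapping.single m 1 * laurent_of_poly p"
proof -
  obtain m :: nat and p where mp: "Poly_Mapping.single (int m) 1 * f = laurent_of_poly p"
    by (rule laurent_cofactor_poly)
  have "f = Poly_Mapping.single (- int m) 1 * (Poly_Mapping.single (int m) 1 * f)"
    by (simp add: mult.assoc[symmetric] mult_single)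
  with mp that show thesis by metis
qed

section \<open>Evaluation at nonzero points\<close>

definition laurent_eval :: "'a::field \<Rightarrow> 'a laurent \<Rightarrow> 'a" where
  "laurent_eval x f = (\<Sum>n\<in>Poly_Mapping.keys f. Poly_Mapping.lookup f n * x powi n)"

lemma laurent_eval_add: "laurent_eval x (f + g) = laurent_eval x f + laurent_eval x g"
  unfolding laurent_eval_def by (rule setsum_keys_plus_distrib) (simp_all add: distrib_right)

lemma laurent_eval_single: "laurent_eval x (Poly_Mapping.single n c) = c * x powi n"
  by (cases "c = 0") (simp_all add: laurent_eval_def)

lemma laurent_eval_mult:
  assumes "x \<noteq> 0"
  shows "laurent_eval x (f * g) = laurent_eval x f * laurent_eval x g"
proof (induction f rule: laurent_induct)
  case (single m a)
  show ?case
  proof (induction g rule: laurent_induct)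
    case (single n b)
    show ?case
      using assms by (simp add: mult_single laurent_eval_single power_int_add)
  qed (simp add: laurent_eval_add algebra_simps)
qed (simp add: laurent_eval_add algebra_simps)

lemma linear_laurent_eval: "Vector_Spaces.linear laurent_scale (*) (laurent_eval x)"
proof unfold_locales
  show "laurent_eval x (laurent_scale c f) = c * laurent_eval x f" for c f
    unfolding laurent_scale_def
    by (induction f rule: laurent_induct)
       (simp_all add: mult_single laurent_eval_single laurent_eval_add algebra_simps)
qed (simp_all add: laurent_eval_add algebra_simps)

lemma laurent_eval_of_poly:
  assumes "x \<noteq> 0"
  shows "laurent_eval x (laurent_of_poly p) = poly p x"
  using assms
  by (induction p)
     (simp_all add: laurent_eval_add laurent_eval_mult laurent_eval_single
       laurent_eval_single[of _ 0 0, simplified])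

text \<open>The factor theorem for Laurent polynomials. It turns membership in the support into the
  vanishing of a linear functional on the subalgebra.\<close>

lemma witt_multiples_linear_iff:
  assumes "x \<noteq> 0"
  shows "f \<in> witt_multiples (laurent_t - laurent_const x) \<longleftrightarrow> laurent_eval x f = 0"
proof
  have lin: "laurent_of_poly [:-x, 1:] = laurent_t - laurent_const x"
    by (simp add: single_uminus)
  have ev: "laurent_eval x (laurent_t - laurent_const x) = 0"
    unfolding lin[symmetric] by (simp add: laurent_eval_of_poly[OF assms] del: laurent_of_poly_pCons)
  show "laurent_eval x f = 0" if "f \<in> witt_multiples (laurent_t - laurent_const x)"
    using that ev by (auto simp: witt_multiples_def laurent_eval_mult[OF assms])
  show "f \<in> witt_multiples (laurent_t - laurent_const x)" if "laurent_eval x f = 0"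
  proof -
    obtain m :: int and p where f: "f = Poly_Mapping.single m 1 * laurent_of_poly p"
      by (rule laurent_eq_shift_poly)
    have "poly p x = 0"
      using that assms
      by (simp add: f laurent_eval_mult laurent_eval_of_poly laurent_eval_single)
    then obtain q where "p = [:-x, 1:] * q"
      by (auto simp: poly_eq_0_iff_dvd elim: dvdE)
    then have "laurent_of_poly p = (laurent_t - laurent_const x) * laurent_of_poly q"
      by (simp only: laurent_of_poly_mult lin)
    then have "f = (laurent_t - laurent_const x) * (Poly_Mapping.single m 1 * laurent_of_poly q)"
      by (simp only: f ac_simps)
    then show ?thesis unfolding witt_multiples_def by blast
  qed
qed

section \<open>Subspaces of finite codimension and linear functionals\<close>

text \<open>The coordinates with respect to a basis of the quotient are well defined and linear. Describing
  \<open>U\<close> by functionals makes intersections and preimages under linear maps trivial: they just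
  amount to more functionals.\<close>

lemma (in vector_space) finite_codim_functionals:
  assumes "subspace U" and "finite_codim scale U"
  obtains \<Phi> where "finite \<Phi>" and "\<And>\<phi>. \<phi> \<in> \<Phi> \<Longrightarrow> Vector_Spaces.linear scale (*) \<phi>"
    and "\<And>v. v \<in> U \<longleftrightarrow> (\<forall>\<phi>\<in>\<Phi>. \<phi> v = 0)"
proof -
  obtain B where "finite B"
    and indep: "\<And>c b. (\<Sum>b\<in>B. scale (c b) b) \<in> U \<Longrightarrow> b \<in> B \<Longrightarrow> c b = 0"
    and span: "\<And>v. \<exists>c. v - (\<Sum>b\<in>B. scale (c b) b) \<in> U"
    using assms(2) unfolding finite_codim_def quotient_basis_def by blast
  obtain \<kappa> where \<kappa>: "\<And>v. v - (\<Sum>b\<in>B. scale (\<kappa> v b) b) \<in> U"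
    using span by metis
  have unique: "c b = \<kappa> v b" if "v - (\<Sum>b\<in>B. scale (c b) b) \<in> U" "b \<in> B" for v c b
  proof -
    have "(v - (\<Sum>b\<in>B. scale (\<kappa> v b) b)) - (v - (\<Sum>b\<in>B. scale (c b) b)) \<in> U"
      using \<kappa> that assms(1) by (blast intro: subspace_diff)
    then have "(\<Sum>b\<in>B. scale (c b - \<kappa> v b) b) \<in> U"
      by (simp add: scale_left_diff_distrib sum_subtractf)
    from indep[OF this that(2)] show ?thesis by simp
  qed
  have add: "\<kappa> (v + w) b = \<kappa> v b + \<kappa> w b" if "b \<in> B" for v w b
  proof -
    have "(v - (\<Sum>b\<in>B. scale (\<kappa> v b) b)) + (w - (\<Sum>b\<in>B. scale (\<kappa> w b) b)) \<in> U"
      using \<kappa> assms(1) by (blast intro: subspace_add)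
    then have "v + w - (\<Sum>b\<in>B. scale (\<kappa> v b + \<kappa> w b) b) \<in> U"
      by (simp add: scale_left_distrib sum.distrib algebra_simps)
    from unique[OF this that] show ?thesis by simp
  qed
  have mul: "\<kappa> (scale r v) b = r * \<kappa> v b" if "b \<in> B" for r v b
  proof -
    have "scale r (v - (\<Sum>b\<in>B. scale (\<kappa> v b) b)) \<in> U"
      using \<kappa> assms(1) by (blast intro: subspace_scale)
    then have "scale r v - (\<Sum>b\<in>B. scale (r * \<kappa> v b) b) \<in> U"
      by (simp add: scale_right_diff_distrib scale_sum_right)
    from unique[OF this that] show ?thesis by simp
  qed
  show thesis
  proof (rule that[of "(\<lambda>b v. \<kappa> v b) ` B"])
    show "finite ((\<lambda>b v. \<kappa> v b) ` B)"
      using \<open>finite B\<close> by blast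
    show "Vector_Spaces.linear scale (*) \<phi>" if "\<phi> \<in> (\<lambda>b v. \<kappa> v b) ` B" for \<phi>
      using that add mul by unfold_locales (auto simp: algebra_simps)
    show "v \<in> U \<longleftrightarrow> (\<forall>\<phi>\<in>(\<lambda>b v. \<kappa> v b) ` B. \<phi> v = 0)" for v
    proof
      assume "v \<in> U"
      then show "\<forall>\<phi>\<in>(\<lambda>b v. \<kappa> v b) ` B. \<phi> v = 0"
        using unique[of v "\<lambda>_. 0"] by auto
    next
      assume "\<forall>\<phi>\<in>(\<lambda>b v. \<kappa> v b) ` B. \<phi> v = 0"
      then show "v \<in> U" using \<kappa>[of v] by simp
    qed
  qed
qed

text \<open>Induction on the functionals: a new functional that does not vanish on the common kernel of the
  old ones is corrected by a multiple of a single vector \<open>u\<close> of that kernel.\<close>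

lemma (in vector_space) functionals_kernel_complement:
  assumes "finite \<Phi>" and "\<And>\<phi>. \<phi> \<in> \<Phi> \<Longrightarrow> Vector_Spaces.linear scale (*) \<phi>"
  shows "\<exists>B. finite B \<and> (\<forall>v. \<exists>w\<in>span B. \<forall>\<phi>\<in>\<Phi>. \<phi> (v - w) = 0)"
  using assms
proof (induction \<Phi>)
  case empty
  show ?case by (intro exI[of _ "{}"]) auto
next
  case (insert \<phi> \<Phi>)
  then obtain B where B: "finite B" "\<And>v. \<exists>w\<in>span B. \<forall>\<phi>\<in>\<Phi>. \<phi> (v - w) = 0" by auto
  show ?case
  proof (cases "\<exists>u. (\<forall>\<psi>\<in>\<Phi>. \<psi> u = 0) \<and> \<phi> u \<noteq> 0")
    case False
    with B show ?thesis by (intro exI[of _ B]) (metis insert_iff)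
  next
    case True
    then obtain u where u: "\<And>\<psi>. \<psi> \<in> \<Phi> \<Longrightarrow> \<psi> u = 0" "\<phi> u \<noteq> 0" by auto
    show ?thesis
    proof (intro exI[of _ "insert u B"] conjI allI)
      show "finite (insert u B)" using B(1) by simp
      fix v
      obtain w where w: "w \<in> span B" "\<And>\<psi>. \<psi> \<in> \<Phi> \<Longrightarrow> \<psi> (v - w) = 0" using B(2) by blast
      define w' where "w' = w + scale (\<phi> (v - w) / \<phi> u) u"
      have "w' \<in> span (insert u B)"
        unfolding w'_def using w(1) span_mono[OF subset_insertI]
        by (intro span_add span_scale) (auto intro: span_base)
      moreover have "\<psi> (v - w') = 0" if "\<psi> \<in> insert \<phi> \<Phi>" for \<psi>
      proof -
        have "\<psi> (v - w') = \<psi> (v - w) - \<phi> (v - w) / \<phi> u * \<psi> u"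
        proof -
          interpret Vector_Spaces.linear scale "(*)" \<psi> using insert.prems that by blast
          have "v - w' = (v - w) - scale (\<phi> (v - w) / \<phi> u) u" by (simp add: w'_def)
          then show ?thesis by (simp only: diff scale)
        qed
        then show ?thesis using that u(1)[of \<psi>] u(2) w(2)[of \<psi>] by auto
      qed
      ultimately show "\<exists>w\<in>span (insert u B). \<forall>\<psi>\<in>insert \<phi> \<Phi>. \<psi> (v - w) = 0"
        by blast
    qed
  qed
qed

lemma lookup_laurent_scale:
  "Poly_Mapping.lookup (laurent_scale c f) n = c * Poly_Mapping.lookup f n"
  unfolding laurent_scale_def
  by (induction f rule: laurent_induct)
     (simp_all add: mult_single lookup_single lookup_add distrib_left when_def)

text \<open>Only finitely many exponents occur in the elements of a finitely generated subspace.\<close>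

lemma laurent_span_finite_neq_UNIV:
  assumes "finite (B :: 'a::field laurent set)"
  shows "laurent.span B \<noteq> UNIV"
proof
  assume all: "laurent.span B = UNIV"
  define K where "K = (\<Union>b\<in>B. Poly_Mapping.keys b)"
  have "laurent.span B \<subseteq> {f. \<forall>n. n \<notin> K \<longrightarrow> Poly_Mapping.lookup f n = 0}"
  proof (rule laurent.span_minimal)
    show "B \<subseteq> {f. \<forall>n. n \<notin> K \<longrightarrow> Poly_Mapping.lookup f n = 0}"
      by (auto simp: K_def in_keys_iff)
    show "laurent.subspace {f. \<forall>n. n \<notin> K \<longrightarrow> Poly_Mapping.lookup f n = (0::'a)}"
      by (rule laurent.subspaceI) (auto simp: lookup_add lookup_laurent_scale)
  qed
  moreover have "finite K"
    using assms by (simp add: K_def)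
  then obtain n where "n \<notin> K"
    using ex_new_if_finite infinite_UNIV_int by blast
  moreover have "Poly_Mapping.lookup (Poly_Mapping.single n (1::'a)) n = 1" by simp
  ultimately show False using all by (metis (mono_tags, lifting) UNIV_I mem_Collect_eq subsetD zero_neq_one)
qed

text \<open>Finitely many vectors span the space modulo the common kernel, so a vector outside their span has
  a nonzero component in that kernel.\<close>

lemma laurent_functionals_common_zero:
  fixes \<Phi> :: "('a::field laurent \<Rightarrow> 'a) set"
  assumes "finite \<Phi>" and "\<And>\<phi>. \<phi> \<in> \<Phi> \<Longrightarrow> Vector_Spaces.linear laurent_scale (*) \<phi>"
  obtains q where "q \<noteq> 0" and "\<And>\<phi>. \<phi> \<in> \<Phi> \<Longrightarrow> \<phi> q = 0"
proof -
  obtain B where B: "finite B" "\<And>v. \<exists>w\<in>laurent.span B. \<forall>\<phi>\<in>\<Phi>. \<phi> (v - w) = 0"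
    using laurent.functionals_kernel_complement[OF assms] by auto
  obtain v where v: "v \<notin> laurent.span B"
    using laurent_span_finite_neq_UNIV[OF B(1)] by auto
  from B(2)[of v] obtain w where "w \<in> laurent.span B" "\<forall>\<phi>\<in>\<Phi>. \<phi> (v - w) = 0" by blast
  with v that[of "v - w"] show thesis by auto
qed

section \<open>Subalgebras of finite codimension contain an ideal\<close>

text \<open>Multiplying one argument of the bracket by \<open>t\<close> creates an undifferentiated product:
  \<open>[f, tg] - [tf, g] = (f(tg)' - f'tg) - (tfg' - (tf)'g) = 2fg\<close>.\<close>

lemma witt_subalgebra_mult_mem:
  fixes L :: "'a::field_char_0 laurent set"
  assumes L: "witt_subalgebra L"
    and "f \<in> L" "laurent_t * f \<in> L" "g \<in> L" "laurent_t * g \<in> L"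
  shows "f * g \<in> L"
proof -
  have sub: "laurent.subspace L" using L by (simp add: witt_subalgebra_def)
  have "witt_bracket f (laurent_t * g) - witt_bracket (laurent_t * f) g \<in> L"
    using assms sub by (intro laurent.subspace_diff) (auto simp: witt_subalgebra_def)
  also have "witt_bracket f (laurent_t * g) - witt_bracket (laurent_t * f) g = f * g + f * g"
    by (simp add: witt_bracket_def laurent_deriv_mult laurent_deriv_t algebra_simps)
  finally have "laurent_scale (1/2) (f * g + f * g) \<in> L"
    by (rule laurent.subspace_scale[OF sub])
  also have "laurent_scale (1/2) (f * g + f * g) = f * g"
    by (simp only: laurent.scale_right_distrib laurent.scale_left_distrib[symmetric]) simp
  finally show ?thesis .
qed

lemma linear_compose_mult:
  assumes "Vector_Spaces.linear laurent_scale (*) \<phi>"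
  shows "Vector_Spaces.linear laurent_scale (*) (\<lambda>f. \<phi> (a * f))"
proof -
  interpret Vector_Spaces.linear laurent_scale "(*)" \<phi> by fact
  show ?thesis
    by unfold_locales
      (simp_all add: distrib_left add scale[symmetric] laurent_scale_def mult.left_commute)
qed

text \<open>Here \<open>\<Psi>\<close> cuts out the space \<open>V\<close> of all \<open>f\<close> with \<open>f\<close> and \<open>tf\<close> in \<open>L\<close>, whose products lie in
  \<open>L\<close>, and \<open>B\<close> is finite with \<open>V + span B\<close> the whole space. An element \<open>q\<close> of \<open>V\<close> that multiplies
  \<open>B\<close> into \<open>L\<close> multiplies everything into \<open>L\<close>; \<open>\<Omega>\<close> collects these finitely many conditions on
  \<open>q\<close>.\<close>

lemma witt_subalgebra_contains_ideal:
  fixes L :: "'a::field_char_0 laurent set"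
  assumes L: "witt_subalgebra L" and fin: "finite_codim laurent_scale L"
  obtains q where "q \<noteq> 0" and "\<And>h. q * h \<in> L"
proof -
  have sub: "laurent.subspace L" using L by (simp add: witt_subalgebra_def)
  obtain \<Phi> where \<Phi>: "finite \<Phi>" "\<And>\<phi>. \<phi> \<in> \<Phi> \<Longrightarrow> Vector_Spaces.linear laurent_scale (*) \<phi>"
    and mem: "\<And>v. v \<in> L \<longleftrightarrow> (\<forall>\<phi>\<in>\<Phi>. \<phi> v = 0)"
    using laurent.finite_codim_functionals[OF sub fin] by metis
  define \<Psi> where "\<Psi> = \<Phi> \<union> (\<lambda>\<phi> f. \<phi> (laurent_t * f)) ` \<Phi>"
  have V: "f \<in> L \<and> laurent_t * f \<in> L" if "\<forall>\<psi>\<in>\<Psi>. \<psi> f = 0" for f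
    using that by (auto simp: mem \<Psi>_def)
  have \<Psi>: "finite \<Psi>" "\<And>\<psi>. \<psi> \<in> \<Psi> \<Longrightarrow> Vector_Spaces.linear laurent_scale (*) \<psi>"
    using \<Phi> by (auto simp: \<Psi>_def intro: linear_compose_mult)
  obtain B where B: "finite B" "\<And>v. \<exists>w\<in>laurent.span B. \<forall>\<psi>\<in>\<Psi>. \<psi> (v - w) = 0"
    using laurent.functionals_kernel_complement[OF \<Psi>] by auto
  define \<Omega> where "\<Omega> = \<Psi> \<union> (\<Union>b\<in>B. (\<lambda>\<phi> f. \<phi> (b * f)) ` \<Phi>)"
  have "finite \<Omega>" "\<And>\<psi>. \<psi> \<in> \<Omega> \<Longrightarrow> Vector_Spaces.linear laurent_scale (*) \<psi>"
    using \<Phi> \<Psi> B(1) by (auto simp: \<Omega>_def intro: linear_compose_mult)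
  then obtain q where q: "q \<noteq> 0" "\<And>\<psi>. \<psi> \<in> \<Omega> \<Longrightarrow> \<psi> q = 0"
    using laurent_functionals_common_zero[of \<Omega>] by blast
  have qV: "\<forall>\<psi>\<in>\<Psi>. \<psi> q = 0" and qB: "\<And>b. b \<in> B \<Longrightarrow> b * q \<in> L"
    using q(2) by (auto simp: \<Omega>_def mem)
  have "laurent.span B \<subseteq> {w. w * q \<in> L}"
  proof (rule laurent.span_minimal)
    show "laurent.subspace {w. w * q \<in> L}"
    proof (rule laurent.subspaceI)
      show "laurent_scale c w \<in> {w. w * q \<in> L}" if "w \<in> {w. w * q \<in> L}" for c w
        using laurent.subspace_scale[OF sub, of "w * q" c] that
        by (simp add: laurent_scale_def mult.assoc)
    qed (auto simp: laurent.subspace_0[OF sub] distrib_right laurent.subspace_add[OF sub])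
  qed (use qB in auto)
  have "q * h \<in> L" for h
  proof -
    obtain w where w: "w \<in> laurent.span B" "\<forall>\<psi>\<in>\<Psi>. \<psi> (h - w) = 0" using B(2) by blast
    have "q * (h - w) \<in> L"
      using V[OF qV] V[OF w(2)] by (blast intro: witt_subalgebra_mult_mem[OF L])
    moreover have "q * w \<in> L"
      using w(1) \<open>laurent.span B \<subseteq> _\<close> by (auto simp: mult.commute)
    ultimately have "q * (h - w) + q * w \<in> L"
      by (rule laurent.subspace_add[OF sub])
    then show ?thesis
      by (simp flip: distrib_left)
  qed
  with q(1) that show thesis by blast
qed

section \<open>Nonemptiness of the support\<close>

text \<open>Every root of the generator \<open>p\<close> of the largest ideal contained in \<open>L\<close> lies in the support: as
  \<open>L\<close> is closed under brackets with that ideal, \<open>p\<close> divides \<open>p'g\<close> for all \<open>g \<in> L\<close>, and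
  differentiation lowers the order of \<open>p\<close> at a root.\<close>

theorem witt_supp_nonempty:
  fixes L :: "'a::{alg_closed_field, field_char_0} laurent set"
  assumes L: "witt_subalgebra L" and fin: "finite_codim laurent_scale L" and "L \<noteq> UNIV"
  shows "witt_supp L \<noteq> {}"
proof -
  have sub: "laurent.subspace L" using L by (simp add: witt_subalgebra_def)
  define I where "I = {p. \<forall>h. laurent_of_poly p * h \<in> L}"
  obtain q where "q \<noteq> 0" and q: "\<And>h. q * h \<in> L"
    using witt_subalgebra_contains_ideal[OF L fin] by blast
  obtain m :: int and r where qr: "q = Poly_Mapping.single m 1 * laurent_of_poly r"
    by (rule laurent_eq_shift_poly)
  have "r \<noteq> 0" using \<open>q \<noteq> 0\<close> qr by auto
  have "laurent_of_poly r = Poly_Mapping.single (-m) 1 * q"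
    by (simp add: qr mult.assoc[symmetric] mult_single)
  then have "r \<in> I"
    using q by (simp add: I_def mult.assoc mult.left_commute)
  define p where "p = (ARG_MIN degree p. p \<in> I \<and> p \<noteq> 0)"
  have p: "p \<in> I" "p \<noteq> 0" and min: "\<And>s. s \<in> I \<Longrightarrow> s \<noteq> 0 \<Longrightarrow> degree p \<le> degree s"
    using arg_min_nat_lemma[of "\<lambda>p. p \<in> I \<and> p \<noteq> 0" r degree] \<open>r \<noteq> 0\<close> \<open>r \<in> I\<close>
    by (auto simp: p_def)
  have generates: "p dvd s" if "s \<in> I" for s
  proof (rule ccontr)
    assume nd: "\<not> p dvd s"
    have "laurent_of_poly s = laurent_of_poly (s mod p) + laurent_of_poly (s div p) * laurent_of_poly p"
      by (metis add.commute div_mult_mod_eq laurent_of_poly_add laurent_of_poly_mult)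
    then have "laurent_of_poly (s mod p) * h
        = laurent_of_poly s * h - laurent_of_poly p * (laurent_of_poly (s div p) * h)" for h
      by (simp add: algebra_simps)
    then have "s mod p \<in> I"
      using p(1) that laurent.subspace_diff[OF sub] by (simp add: I_def)
    with min nd degree_mod_less_degree[OF p(2) nd] show False
      by (metis leD mod_eq_0_iff_dvd)
  qed
  have "degree p \<noteq> 0"
  proof
    assume "degree p = 0"
    then obtain c where c: "p = [:c:]" by (rule degree_eq_zeroE)
    have "h \<in> L" for h
    proof -
      have "laurent_of_poly p * (laurent_const (inverse c) * h) = h"
        using p(2) by (simp add: c mult.assoc[symmetric] mult_single)
      then show ?thesis using p(1) by (metis (mono_tags, lifting) I_def mem_Collect_eq)
    qed
    with \<open>L \<noteq> UNIV\<close> show False by blast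
  qed
  then obtain x where x: "poly p x = 0"
    using alg_closed_imp_poly_has_root by blast
  have "x \<noteq> 0"
  proof
    assume "x = 0"
    with x obtain s where s: "p = [:0, 1:] * s"
      by (auto simp: poly_eq_0_iff_dvd elim: dvdE)
    \<comment> \<open>As \<open>t\<close> is a unit, \<open>p / t\<close> generates the same ideal as \<open>p\<close> but has smaller degree.\<close>
    have X: "laurent_of_poly [:0, 1:] = (laurent_t :: 'a laurent)" by simp
    have "laurent_of_poly p * (Poly_Mapping.single (-1) 1 * h)
        = (laurent_t * Poly_Mapping.single (-1) 1) * (laurent_of_poly s * h)" for h
      unfolding s laurent_of_poly_mult X by (simp only: ac_simps)
    moreover have "laurent_t * Poly_Mapping.single (-1) 1 = (1 :: 'a laurent)"
      by (simp add: mult_single)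
    ultimately have "laurent_of_poly s * h = laurent_of_poly p * (Poly_Mapping.single (-1) 1 * h)"
      for h
      by (simp only: mult_1_left)
    then have "s \<in> I" using p(1) unfolding I_def by (simp only: mem_Collect_eq) simp
    with generates have "p dvd s" by blast
    then show False using p(2) s dvd_imp_degree_le[of p s] by (auto simp: degree_mult_eq)
  qed
  have "laurent_eval x g = 0" if "g \<in> L" for g
  proof -
    obtain k :: int and s where g: "g = Poly_Mapping.single k 1 * laurent_of_poly s"
      by (rule laurent_eq_shift_poly)
    \<comment> \<open>The unit \<open>t^k\<close> by which \<open>g\<close> differs from \<open>s\<close> is absorbed into the multiplier \<open>u\<close>.\<close>
    have "pderiv p * s \<in> I"
      unfolding I_def
    proof (intro CollectI allI)
      fix h :: "'a laurent"
      define F where "F = laurent_of_poly p"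
      define u where "u = Poly_Mapping.single (-k) 1 * h"
      have F: "F * v \<in> L" for v using p(1) by (simp add: F_def I_def)
      have "witt_bracket g (F * u) \<in> L"
        using L that F by (simp add: witt_subalgebra_def)
      then have "witt_bracket g (F * u) - F * (g * laurent_deriv u - laurent_deriv g * u) \<in> L"
        using F by (rule laurent.subspace_diff[OF sub])
      also have "witt_bracket g (F * u) - F * (g * laurent_deriv u - laurent_deriv g * u)
          = laurent_deriv F * (g * u)"
        by (simp add: witt_bracket_def laurent_deriv_mult algebra_simps)
      also have "g * u = (Poly_Mapping.single k 1 * Poly_Mapping.single (-k) 1) * (laurent_of_poly s * h)"
        by (simp only: g u_def ac_simps)
      also have "\<dots> = laurent_of_poly s * h" by (simp add: mult_single)
      finally show "laurent_of_poly (pderiv p * s) * h \<in> L"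
        by (simp add: laurent_of_poly_mult laurent_of_poly_pderiv F_def mult.assoc)
    qed
    then have dvd: "p dvd pderiv p * s" by (rule generates)
    have "poly s x = 0"
    proof (rule ccontr)
      assume s: "poly s x \<noteq> 0"
      have "pderiv p \<noteq> 0" using \<open>degree p \<noteq> 0\<close> by (simp add: pderiv_eq_0_iff)
      with s have nz: "pderiv p * s \<noteq> 0" by auto
      have "order x p \<le> order x (pderiv p * s)" by (rule dvd_imp_order_le[OF nz dvd])
      also have "\<dots> = order x (pderiv p)" using s by (simp add: order_mult[OF nz] order_0I)
      finally show False using order_pderiv[OF p(2) x] by simp
    qed
    then show ?thesis using \<open>x \<noteq> 0\<close> by (simp add: g laurent_eval_mult laurent_eval_of_poly)
  qed
  then have "x \<in> witt_supp L"
    unfolding witt_supp_def using \<open>x \<noteq> 0\<close> witt_multiples_linear_iff by blast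
  then show ?thesis by blast
qed

section \<open>The size of the support\<close>

lemma quotient_basis_UNIV: "quotient_basis scale UNIV B \<Longrightarrow> B = {}"
  using zero_neq_one unfolding quotient_basis_def by (auto dest: spec[of _ "\<lambda>_. 1"])

text \<open>Lagrange interpolation: it makes the evaluations at the points of \<open>X\<close> linearly independent.\<close>

lemma laurent_interpolation:
  fixes X :: "'a::field set"
  assumes "finite X" and "0 \<notin> X" and "x \<in> X"
  obtains l where "\<And>y. y \<in> X \<Longrightarrow> laurent_eval y l = (if y = x then 1 else 0)"
proof -
  define p where "p = (\<Prod>y\<in>X - {x}. [:-y, 1:])"
  have p: "poly p z = (\<Prod>y\<in>X - {x}. z - y)" for z
    by (simp add: p_def poly_prod)
  have nz: "poly p x \<noteq> 0"
    using assms(1) by (auto simp: p)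
  have "laurent_eval y (laurent_of_poly (smult (inverse (poly p x)) p)) = (if y = x then 1 else 0)"
    if "y \<in> X" for y
  proof -
    have "y \<noteq> 0" using that assms(2) by blast
    moreover have "poly p y = 0" if "y \<noteq> x"
      using \<open>y \<in> X\<close> that assms(1) by (auto simp: p prod_zero_iff)
    ultimately show ?thesis using nz by (simp add: laurent_eval_of_poly)
  qed
  with that show thesis by blast
qed

text \<open>Evaluations at points of \<open>X\<close> do not change modulo \<open>L\<close>, so Lagrange polynomials can be replaced
  by vectors \<open>W x\<close> in the span of \<open>B\<close>. These are linearly independent, which bounds their number;
  if there are as many as \<open>B\<close> has elements, they span the same space as \<open>B\<close>, so an element of
  \<open>span B\<close> vanishing on \<open>X\<close> is zero.\<close>

lemma witt_supp_bounded_by_codim: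
  fixes L :: "'a::field laurent set"
  assumes B: "quotient_basis laurent_scale L B" and X: "finite X" "X \<subseteq> witt_supp L"
  shows "card X \<le> card B"
    and "card X = card B \<Longrightarrow> laurent.subspace L \<Longrightarrow> L = {f. \<forall>x\<in>X. laurent_eval x f = 0}"
proof -
  have vanish: "laurent_eval x f = 0" if "f \<in> L" "x \<in> X" for f x
    using that X(2) witt_multiples_linear_iff[of x f] by (auto simp: witt_supp_def)
  have "finite B" using B by (simp add: quotient_basis_def)
  have decomp: "\<exists>w\<in>laurent.span B. f - w \<in> L" for f
  proof -
    obtain c where "f - (\<Sum>b\<in>B. laurent_scale (c b) b) \<in> L"
      using B unfolding quotient_basis_def by blast
    moreover have "(\<Sum>b\<in>B. laurent_scale (c b) b) \<in> laurent.span B"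
      by (intro laurent.span_sum laurent.span_scale laurent.span_base)
    ultimately show ?thesis by blast
  qed
  have eval_diff: "laurent_eval x (f - g) = laurent_eval x f - laurent_eval x g" for x :: 'a and f g
    by (rule module_hom.diff[OF linear_laurent_eval[unfolded linear_iff_module_hom]])
  have "\<exists>w\<in>laurent.span B. \<forall>y\<in>X. laurent_eval y w = (if y = x then 1 else 0)" if x: "x \<in> X" for x
  proof -
    have "0 \<notin> X" using X(2) by (auto simp: witt_supp_def)
    then obtain l where l: "\<And>y. y \<in> X \<Longrightarrow> laurent_eval y l = (if y = x then 1 else 0)"
      using laurent_interpolation[OF X(1) _ x] by blast
    obtain w where w: "w \<in> laurent.span B" "l - w \<in> L" using decomp by blast
    have "laurent_eval y w = laurent_eval y l" if "y \<in> X" for y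
      using vanish[OF w(2) that] by (simp add: eval_diff)
    with w(1) l show ?thesis by (intro bexI[of _ w]) auto
  qed
  then obtain W where W: "\<And>x. x \<in> X \<Longrightarrow> W x \<in> laurent.span B"
    and eval_W: "\<And>x y. x \<in> X \<Longrightarrow> y \<in> X \<Longrightarrow> laurent_eval y (W x) = (if y = x then 1 else 0)"
    by metis
  have inj: "inj_on W X"
    by (rule inj_onI) (metis eval_W zero_neq_one)
  have coeff: "laurent_eval y (\<Sum>v\<in>W ` X. laurent_scale (c v) v) = c (W y)" if "y \<in> X" for c y
  proof -
    interpret Vector_Spaces.linear laurent_scale "(*)" "laurent_eval y" by (rule linear_laurent_eval)
    have "laurent_eval y (\<Sum>v\<in>W ` X. laurent_scale (c v) v) = (\<Sum>x\<in>X. c (W x) * laurent_eval y (W x))"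
      by (simp add: sum.reindex[OF inj] sum scale)
    also have "\<dots> = (\<Sum>x\<in>X. if y = x then c (W x) else 0)"
      using that by (intro sum.cong) (auto simp: eval_W)
    finally show ?thesis using that X(1) by simp
  qed
  have indep: "laurent.independent (W ` X)"
  proof (rule laurent.independent_if_scalars_zero)
    show "finite (W ` X)" using X(1) by blast
    show "c v = 0" if "(\<Sum>v\<in>W ` X. laurent_scale (c v) v) = 0" "v \<in> W ` X" for c v
      using that coeff[of _ c] by (auto simp: laurent_eval_def)
  qed
  have bound: "card S \<le> card B" if "laurent.independent S" "S \<subseteq> laurent.span B" for S
    using laurent.independent_span_bound[OF \<open>finite B\<close> that] by blast
  show "card X \<le> card B"
    using bound[OF indep] W by (auto simp: card_image[OF inj])
  show "L = {f. \<forall>x\<in>X. laurent_eval x f = 0}"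
    if eq: "card X = card B" and sub: "laurent.subspace L"
  proof (intro equalityI subsetI)
    fix f assume "f \<in> L" then show "f \<in> {f. \<forall>x\<in>X. laurent_eval x f = 0}" using vanish by blast
  next
    fix f assume f: "f \<in> {f. \<forall>x\<in>X. laurent_eval x f = 0}"
    obtain w where w: "w \<in> laurent.span B" "f - w \<in> L" using decomp by blast
    have w0: "laurent_eval x w = 0" if "x \<in> X" for x
      using vanish[OF w(2) that] f that by (simp add: eval_diff)
    have "w \<in> laurent.span (W ` X)"
    proof (rule ccontr)
      assume nw: "w \<notin> laurent.span (W ` X)"
      then have "laurent.independent (insert w (W ` X))"
        using indep by (rule laurent.independent_insertI)
      then have "card (insert w (W ` X)) \<le> card B"
        using W w(1) by (intro bound) auto
      moreover have "w \<notin> W ` X" using nw laurent.span_base by blast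
      ultimately show False using X(1) eq by (simp add: card_image[OF inj])
    qed
    then obtain c where c: "w = (\<Sum>v\<in>W ` X. laurent_scale (c v) v)"
      using X(1) by (auto simp: laurent.span_finite)
    have "c v = 0" if "v \<in> W ` X" for v
      using that coeff[of _ c] w0 by (auto simp: c)
    then have "w = 0" by (simp add: c)
    with w(2) show "f \<in> L" by simp
  qed
qed

lemma witt_multiples_two_roots:
  fixes x y :: "'a::field"
  assumes "x \<noteq> 0" "y \<noteq> 0" "x \<noteq> y"
  shows "witt_multiples ((laurent_t - laurent_const x) * (laurent_t - laurent_const y))
      = {f. laurent_eval x f = 0 \<and> laurent_eval y f = 0}" (is "?M = ?Z")
proof (intro equalityI subsetI)
  fix f assume "f \<in> ?M"
  then obtain h where h: "f = (laurent_t - laurent_const x) * (laurent_t - laurent_const y) * h"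
    by (auto simp: witt_multiples_def)
  then have "f = (laurent_t - laurent_const y) * ((laurent_t - laurent_const x) * h)"
    by (simp only: ac_simps)
  with h show "f \<in> ?Z"
    using assms by (auto simp: witt_multiples_linear_iff[symmetric] witt_multiples_def mult.assoc)
next
  fix f assume f: "f \<in> ?Z"
  then obtain h where h: "f = (laurent_t - laurent_const x) * h"
    using assms(1) by (auto simp: witt_multiples_linear_iff[symmetric] witt_multiples_def)
  have "laurent_eval y (laurent_t - laurent_const x) = y - x"
    using laurent_eval_of_poly[OF assms(2), of "[:-x, 1:]"] by (simp add: single_uminus)
  then have "laurent_eval y h = 0"
    using f assms by (simp add: h laurent_eval_mult)
  then obtain k where "h = (laurent_t - laurent_const y) * k"
    using assms(2) by (auto simp: witt_multiples_linear_iff[symmetric] witt_multiples_def)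
  then show "f \<in> ?M" by (auto simp: h witt_multiples_def mult.assoc)
qed

section \<open>Subalgebras of codimension two\<close>

theorem proposition6p2p1:
  fixes L :: "'a::{alg_closed_field, field_char_0} laurent set"
  assumes "uncountable (UNIV :: 'a set)"
    and "witt_subalgebra L"
    and "finite_codim laurent_scale L"
  shows "(codim laurent_scale L = 2 \<longrightarrow> card (witt_supp L) \<in> {1, 2}) \<and>
    (codim laurent_scale L = 2 \<and> card (witt_supp L) = 2 \<longrightarrow>
      (\<exists>x y. x \<noteq> 0 \<and> y \<noteq> 0 \<and> x \<noteq> y \<and>
        L = witt_multiples ((laurent_t - laurent_const x) * (laurent_t - laurent_const y)) \<and>
        witt_supp L = {x, y}))"
proof (intro conjI impI)
  obtain B where B: "quotient_basis laurent_scale L B" and card_B: "card B = codim laurent_scale L"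
    using assms(3) someI_ex[of "quotient_basis laurent_scale L"]
    unfolding finite_codim_def codim_def by blast
  {
    assume codim: "codim laurent_scale L = 2"
    then have "L \<noteq> UNIV"
      using B card_B by (auto dest: quotient_basis_UNIV)
    with assms(2,3) have "witt_supp L \<noteq> {}"
      by (rule witt_supp_nonempty)
    moreover have "finite (witt_supp L) \<and> card (witt_supp L) \<le> 2"
      using witt_supp_bounded_by_codim(1)[OF B] card_B codim
      by (intro finite_if_finite_subsets_card_bdd) auto
    ultimately have "card (witt_supp L) \<noteq> 0" "card (witt_supp L) \<le> 2" by auto
    then show "card (witt_supp L) \<in> {1, 2}" by auto
  }
  assume codim: "codim laurent_scale L = 2 \<and> card (witt_supp L) = 2"
  then obtain x y where xy: "witt_supp L = {x, y}" "x \<noteq> y" by (auto simp: card_2_iff)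
  then have nz: "x \<noteq> 0" "y \<noteq> 0" by (auto simp: witt_supp_def)
  have "L = {f. \<forall>z\<in>witt_supp L. laurent_eval z f = 0}"
    using codim card_B assms(2)
    by (intro witt_supp_bounded_by_codim(2)[OF B]) (auto simp: xy witt_subalgebra_def)
  then have "L = witt_multiples ((laurent_t - laurent_const x) * (laurent_t - laurent_const y))"
    using witt_multiples_two_roots[OF nz xy(2)] by (simp add: xy(1))
  with xy nz show "\<exists>x y. x \<noteq> 0 \<and> y \<noteq> 0 \<and> x \<noteq> y \<and>
        L = witt_multiples ((laurent_t - laurent_const x) * (laurent_t - laurent_const y)) \<and>
        witt_supp L = {x, y}"
    by blast
qed

end
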